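(* Let $f:\mathbb{R}^{n\times p}\to\mathbb{R}^{r\times p}$ be a max-definable function. Then $f$ is a $t$-layer ($\operatorname{ReLU}$-activated) encoder for some finite $t\in\mathbb{N}$. More precisely, there exist $t$ attention modules $\alpha_1,\dots,\alpha_t$ and $t$ one-layer neural networks $\varphi_1,\dots,\varphi_t$ such that $$f=\varphi_t\circ\alpha_t\circ\varphi_{t-1}\circ\alpha_{t-1}\circ\cdots\circ\varphi_1\circ\alpha_1.$$ If the Pierce--Birkhoff conjecture holds, then any degree-$k$ spline $f:\mathbb{R}^{n\times p}\to\mathbb{R}^{r\times p}$ is an encoder.
   Context: **Max-definable functions.** A function $\mathbb{R}^N\to\mathbb{R}$ is max-definable if it belongs to the set of functions generated by $1,x_1,\dots,x_N$ under addition, multiplication, pairwise maximum, and multiplication by real scalars (equivalently, it is of the form $\max_{i}\min_{j}\xi_{ij}$ for a finite family of polynomials $\xi_{ij}\in\mathbb{R}[x_1,\dots,x_N]$, $i=1,\dots,m'$, $j=1,\dots,p'$). A function $\mathbb{R}^{n\times p}\to\mathbb{R}^{r\times p}$ is max-definable if each of its entries is a max-definable function of the $np$ entries of its argument. **Splines.** Given polynomials $\pi_1,\dots,\pi_b\in\mathbb{R}[x_1,\dots,x_N]$ and $\theta:\{1,\dots,b\}\to\{1,0,-1\}$, let $\Pi_\theta=\{x\in\mathbb{R}^N:\operatorname{sgn}(\pi_i(x))=\theta(i),\ i=1,\dots,b\}$. A continuous function $f:\mathbb{R}^N\to\mathbb{R}$ is a spline of degree $k$ (with respect to $\pi_1,\dots,\pi_b$)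 if every $\pi_i$ has degree not more than $k$ and, on each nonempty $\Pi_\theta$, $f$ agrees with some polynomial of degree not more than $k$. A matrix-valued function of a matrix variable is a spline of degree $k$ if all its entries, as functions of the entries of the variable, are splines of degree $k$ with respect to common $\pi_1,\dots,\pi_b$. A spline is a spline of degree $k$ for some $k$. **Pierce--Birkhoff conjecture.** For every $N$ and every spline $f:\mathbb{R}^N\to\mathbb{R}$ there is a finite set of polynomials $\xi_{ij}\in\mathbb{R}[x_1,\dots,x_N]$, $i=1,\dots,m'$, $j=1,\dots,p'$, with $f=\max_i\min_j\xi_{ij}$. **Neural networks.** $\operatorname{ReLU}(x)=\max(x,0)$, applied entrywise. An $l$-layer neural network is a map $\varphi:\mathbb{R}^n\to\mathbb{R}^{n_{l+1}}$, $\varphi(x)=A_{l+1}\sigma_lA_l\cdots\sigma_1A_1x+b_{l+1}$ with $A_i\in\mathbb{R}^{n_i\times n_{i-1}}$, $n_0=n$, $\sigma_i(x)=\operatorname{ReLU}(x+b_i)$, $b_i\in\mathbb{R}^{n_i}$; so a one-layer neural network is $x\mapsto A_2\operatorname{ReLU}(A_1x+b_1)+b_2$. Applied to a matrix in $\mathbb{R}^{n\times p}$, it acts on each of the $p$ columns separately. **Attention modules.** A single-head attention module is a map $\alpha:\mathbb{R}^{n\times p}\to\mathbb{R}^{m\times p}$, $\alpha(X)=V(X)\operatorname{ReLU}(K(X)^{\mathsf T}Q(X))$, where $Q(X)=A_QX+B_Q$, $K(X)=A_KX+B_K$, $V(X)=A_VX+B_V$ with $A_Q,A_K\in\mathbb{R}^{d\times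 n}$, $A_V\in\mathbb{R}^{m\times n}$, $B_Q,B_K\in\mathbb{R}^{d\times p}$, $B_V\in\mathbb{R}^{m\times p}$ arbitrary. An ($h$-headed) attention module $\mathbb{R}^{n\times p}\to\mathbb{R}^{mh\times p}$ is obtained by stacking the outputs of $h$ single-head attention modules vertically; "attention module" in the claim means $h$-headed for some $h\ge1$. **Encoders.** A $t$-layer encoder is a composition $\varphi_t\circ\alpha_t\circ\cdots\circ\varphi_1\circ\alpha_1$ with each $\alpha_i$ a (multihead) attention module and each $\varphi_i$ a neural network, of compatible dimensions. An encoder is a $t$-layer encoder for some $t$. *)

theory Defs
  imports
    "HOL-Analysis.Abstract_Euclidean_Space"
    "HOL-Library.Poly_Mapping"
    "Jordan_Normal_Form.Matrix"
begin

text \<open>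
  The dimensions of intermediate spaces are existentially quantified, so they cannot be types.
  Matrices and columns are those of \<^theory>\<open>Jordan_Normal_Form.Matrix\<close>, with carriers
  \<^term>\<open>carrier_mat n p\<close> and \<^term>\<open>carrier_vec n\<close>. For scalar functions of \<open>N\<close> real variables,
  the space of arguments is \<^term>\<open>topspace (Euclidean_space N)\<close>, whose elements
  \<open>x :: nat \<Rightarrow> real\<close> vanish from \<open>N\<close> on; the variable \<open>x\<^sub>i\<close> of the text is \<open>x (i - 1)\<close>. Functions
  are total in HOL, and are constrained on these carriers only.
\<close>

abbreviation Rn :: "nat \<Rightarrow> (nat \<Rightarrow> real) set"
  where "Rn N \<equiv> topspace (Euclidean_space N)"

text \<open>
  The identification of \<open>n \<times> p\<close> matrices with points of dimension \<open>n * p\<close> is row by row: the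
  entry in row \<open>a\<close> and column \<open>c\<close> is coordinate \<open>a * p + c\<close>.
\<close>

definition mat_of_point :: "nat \<Rightarrow> nat \<Rightarrow> (nat \<Rightarrow> real) \<Rightarrow> real mat"
  where "mat_of_point n p x = mat n p (\<lambda>(a, c). x (a * p + c))"

definition entry_fun ::
    "nat \<Rightarrow> nat \<Rightarrow> (real mat \<Rightarrow> real mat) \<Rightarrow> nat \<Rightarrow> nat \<Rightarrow> (nat \<Rightarrow> real) \<Rightarrow> real"
  where "entry_fun n p f i j = (\<lambda>x. f (mat_of_point n p x) $$ (i, j))"


section \<open>Max-definable functions\<close>

inductive_set max_generated :: "nat \<Rightarrow> ((nat \<Rightarrow> real) \<Rightarrow> real) set" for N :: nat
  where
    one: "(\<lambda>x. 1) \<in> max_generated N"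
  | var: "i < N \<Longrightarrow> (\<lambda>x. x i) \<in> max_generated N"
  | add: "g \<in> max_generated N \<Longrightarrow> h \<in> max_generated N \<Longrightarrow> (\<lambda>x. g x + h x) \<in> max_generated N"
  | mult: "g \<in> max_generated N \<Longrightarrow> h \<in> max_generated N \<Longrightarrow> (\<lambda>x. g x * h x) \<in> max_generated N"
  | max: "g \<in> max_generated N \<Longrightarrow> h \<in> max_generated N \<Longrightarrow> (\<lambda>x. max (g x) (h x)) \<in> max_generated N"
  | scale: "g \<in> max_generated N \<Longrightarrow> (\<lambda>x. c * g x) \<in> max_generated N"

definition max_definable :: "nat \<Rightarrow> ((nat \<Rightarrow> real) \<Rightarrow> real) \<Rightarrow> bool"
  where "max_definable N f \<longleftrightarrow> (\<exists>g \<in> max_generated N. \<forall>x \<in> Rn N. f x = g x)"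

definition max_definable_mat :: "nat \<Rightarrow> nat \<Rightarrow> nat \<Rightarrow> (real mat \<Rightarrow> real mat) \<Rightarrow> bool"
  where "max_definable_mat n p r f \<longleftrightarrow>
    (\<forall>i<r. \<forall>j<p. max_definable (n * p) (entry_fun n p f i j))"


section \<open>Multivariate polynomials\<close>

text \<open>Coefficients indexed by monomials, monomials being finitely supported exponent maps.\<close>

type_synonym mpoly = "(nat \<Rightarrow>\<^sub>0 nat) \<Rightarrow>\<^sub>0 real"

definition mpolys :: "nat \<Rightarrow> mpoly set"
  where "mpolys N = {P. \<forall>m \<in> Poly_Mapping.keys P. Poly_Mapping.keys m \<subseteq> {..<N}}"

definition mpoly_eval :: "mpoly \<Rightarrow> (nat \<Rightarrow> real) \<Rightarrow> real"
  where "mpoly_eval P x =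
    (\<Sum>m \<in> Poly_Mapping.keys P. Poly_Mapping.lookup P m *
      (\<Prod>i \<in> Poly_Mapping.keys m. x i ^ Poly_Mapping.lookup m i))"

definition monom_degree :: "(nat \<Rightarrow>\<^sub>0 nat) \<Rightarrow> nat"
  where "monom_degree m = (\<Sum>i \<in> Poly_Mapping.keys m. Poly_Mapping.lookup m i)"

text \<open>Total degree; the zero polynomial gets degree 0.\<close>

definition mpoly_degree :: "mpoly \<Rightarrow> nat"
  where "mpoly_degree P = Max (insert 0 (monom_degree ` Poly_Mapping.keys P))"


section \<open>Splines and the Pierce--Birkhoff conjecture\<close>

definition sign_cell :: "nat \<Rightarrow> mpoly list \<Rightarrow> (nat \<Rightarrow> real) \<Rightarrow> (nat \<Rightarrow> real) set"
  where "sign_cell N \<pi> \<theta> = {x \<in> Rn N. \<forall>i < length \<pi>. sgn (mpoly_eval (\<pi> ! i) x) = \<theta> i}"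

definition spline_wrt :: "nat \<Rightarrow> nat \<Rightarrow> mpoly list \<Rightarrow> ((nat \<Rightarrow> real) \<Rightarrow> real) \<Rightarrow> bool"
  where "spline_wrt k N \<pi> f \<longleftrightarrow>
    continuous_map (Euclidean_space N) euclideanreal f \<and>
    (\<forall>P \<in> set \<pi>. P \<in> mpolys N \<and> mpoly_degree P \<le> k) \<and>
    (\<forall>\<theta> \<in> {..<length \<pi>} \<rightarrow> {1, 0, -1}. sign_cell N \<pi> \<theta> \<noteq> {} \<longrightarrow>
      (\<exists>\<xi> \<in> mpolys N. mpoly_degree \<xi> \<le> k \<and>
        (\<forall>x \<in> sign_cell N \<pi> \<theta>. f x = mpoly_eval \<xi> x)))"

definition spline :: "nat \<Rightarrow> ((nat \<Rightarrow> real) \<Rightarrow> real) \<Rightarrow> bool"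
  where "spline N f \<longleftrightarrow> (\<exists>k \<pi>. spline_wrt k N \<pi> f)"

definition spline_mat :: "nat \<Rightarrow> nat \<Rightarrow> nat \<Rightarrow> nat \<Rightarrow> (real mat \<Rightarrow> real mat) \<Rightarrow> bool"
  where "spline_mat k n p r f \<longleftrightarrow>
    (\<exists>\<pi>. \<forall>i<r. \<forall>j<p. spline_wrt k (n * p) \<pi> (entry_fun n p f i j))"

definition Pierce_Birkhoff :: bool
  where "Pierce_Birkhoff \<longleftrightarrow>
    (\<forall>N f. spline N f \<longrightarrow>
      (\<exists>(m' :: nat) (p' :: nat) \<xi>. 1 \<le> m' \<and> 1 \<le> p' \<and>
        (\<forall>i \<in> {1..m'}. \<forall>j \<in> {1..p'}. \<xi> i j \<in> mpolys N) \<and>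
        (\<forall>x \<in> Rn N. f x =
          Max ((\<lambda>i. Min ((\<lambda>j. mpoly_eval (\<xi> i j) x) ` {1..p'})) ` {1..m'}))))"


section \<open>Neural networks\<close>

definition ReLU :: "real \<Rightarrow> real"
  where "ReLU x = max x 0"

text \<open>\<open>hidden A b i x\<close> is \<open>\<sigma>\<^sub>i A\<^sub>i \<dots> \<sigma>\<^sub>1 A\<^sub>1 x\<close>.\<close>

primrec hidden ::
    "(nat \<Rightarrow> real mat) \<Rightarrow> (nat \<Rightarrow> real vec) \<Rightarrow> nat \<Rightarrow> real vec \<Rightarrow> real vec"
  where
    "hidden A b 0 x = x"
  | "hidden A b (Suc i) x = map_vec ReLU (A (Suc i) *\<^sub>v hidden A b i x + b (Suc i))"

text \<open>\<open>neural_network l n q \<phi>\<close>: \<open>\<phi>\<close> is an \<open>l\<close>-layer network from dimension \<open>n\<close> to dimension \<open>q\<close>.\<close>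

definition neural_network :: "nat \<Rightarrow> nat \<Rightarrow> nat \<Rightarrow> (real vec \<Rightarrow> real vec) \<Rightarrow> bool"
  where "neural_network l n q \<phi> \<longleftrightarrow>
    (\<exists>d A b. d 0 = n \<and> d (l + 1) = q \<and>
      (\<forall>i \<in> {0..l + 1}. 1 \<le> d i) \<and>
      (\<forall>i \<in> {1..l + 1}. A i \<in> carrier_mat (d i) (d (i - 1)) \<and> b i \<in> carrier_vec (d i)) \<and>
      (\<forall>x \<in> carrier_vec n. \<phi> x = A (l + 1) *\<^sub>v hidden A b l x + b (l + 1)))"

definition columnwise_network ::
    "nat \<Rightarrow> nat \<Rightarrow> nat \<Rightarrow> nat \<Rightarrow> (real mat \<Rightarrow> real mat) \<Rightarrow> bool"
  where "columnwise_network p l n q \<Phi> \<longleftrightarrow>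
    (\<exists>\<phi>. neural_network l n q \<phi> \<and>
      (\<forall>X \<in> carrier_mat n p. \<Phi> X = mat_of_cols q (map \<phi> (cols X))))"


section \<open>Attention modules\<close>

definition single_head_attention ::
    "nat \<Rightarrow> nat \<Rightarrow> nat \<Rightarrow> (real mat \<Rightarrow> real mat) \<Rightarrow> bool"
  where "single_head_attention p n m \<alpha> \<longleftrightarrow> 1 \<le> m \<and>
    (\<exists>d AQ AK AV BQ BK BV. 1 \<le> d \<and>
      AQ \<in> carrier_mat d n \<and> AK \<in> carrier_mat d n \<and> AV \<in> carrier_mat m n \<and>
      BQ \<in> carrier_mat d p \<and> BK \<in> carrier_mat d p \<and> BV \<in> carrier_mat m p \<and>
      (\<forall>X \<in> carrier_mat n p.
        \<alpha> X = (AV * X + BV) *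
          map_mat ReLU (transpose_mat (AK * X + BK) * (AQ * X + BQ))))"

text \<open>
  \<open>attention_module p n q \<alpha>\<close>: \<open>\<alpha>\<close> maps \<open>n \<times> p\<close> matrices to \<open>q \<times> p\<close> matrices, \<open>q = m * h\<close>, by
  stacking the \<open>m \<times> p\<close> outputs of the heads \<open>H 0, \<dots>, H (h - 1)\<close> vertically.
\<close>

definition attention_module ::
    "nat \<Rightarrow> nat \<Rightarrow> nat \<Rightarrow> (real mat \<Rightarrow> real mat) \<Rightarrow> bool"
  where "attention_module p n q \<alpha> \<longleftrightarrow>
    (\<exists>h m H. 1 \<le> h \<and> q = m * h \<and>
      (\<forall>s<h. single_head_attention p n m (H s)) \<and>
      (\<forall>X \<in> carrier_mat n p.
        \<alpha> X = mat (m * h) p (\<lambda>(i, j). H (i div m) X $$ (i mod m, j))))"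


section \<open>Encoders\<close>

text \<open>\<open>alternate \<alpha> \<phi> t\<close> is \<open>\<phi>\<^sub>t \<circ> \<alpha>\<^sub>t \<circ> \<dots> \<circ> \<phi>\<^sub>1 \<circ> \<alpha>\<^sub>1\<close>.\<close>

primrec alternate ::
    "(nat \<Rightarrow> 'a \<Rightarrow> 'a) \<Rightarrow> (nat \<Rightarrow> 'a \<Rightarrow> 'a) \<Rightarrow> nat \<Rightarrow> 'a \<Rightarrow> 'a"
  where
    "alternate \<alpha> \<phi> 0 = id"
  | "alternate \<alpha> \<phi> (Suc i) = \<phi> (Suc i) \<circ> \<alpha> (Suc i) \<circ> alternate \<alpha> \<phi> i"

text \<open>
  \<open>encoder_layers t l n p r \<alpha> \<phi>\<close>: the \<open>\<alpha> i\<close> are attention modules and the \<open>\<phi> i\<close> are \<open>l i\<close>-layer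
  networks, for \<open>i = 1, \<dots>, t\<close>, of dimensions compatible with a composition from \<open>n \<times> p\<close>
  matrices to \<open>r \<times> p\<close> matrices.
\<close>

definition encoder_layers ::
    "nat \<Rightarrow> (nat \<Rightarrow> nat) \<Rightarrow> nat \<Rightarrow> nat \<Rightarrow> nat \<Rightarrow>
      (nat \<Rightarrow> real mat \<Rightarrow> real mat) \<Rightarrow> (nat \<Rightarrow> real mat \<Rightarrow> real mat) \<Rightarrow> bool"
  where "encoder_layers t l n p r \<alpha> \<phi> \<longleftrightarrow>
    (\<exists>\<mu> \<nu>. \<nu> 0 = n \<and> \<nu> t = r \<and>
      (\<forall>i \<in> {1..t}.
        attention_module p (\<nu> (i - 1)) (\<mu> i) (\<alpha> i) \<and>
        columnwise_network p (l i) (\<mu> i) (\<nu> i) (\<phi> i)))"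

definition t_layer_encoder ::
    "nat \<Rightarrow> nat \<Rightarrow> nat \<Rightarrow> nat \<Rightarrow> (real mat \<Rightarrow> real mat) \<Rightarrow> bool"
  where "t_layer_encoder t n p r f \<longleftrightarrow> 1 \<le> t \<and>
    (\<exists>l \<alpha> \<phi>. (\<forall>i \<in> {1..t}. 1 \<le> l i) \<and> encoder_layers t l n p r \<alpha> \<phi> \<and>
      (\<forall>X \<in> carrier_mat n p. f X = alternate \<alpha> \<phi> t X))"

definition encoder :: "nat \<Rightarrow> nat \<Rightarrow> nat \<Rightarrow> (real mat \<Rightarrow> real mat) \<Rightarrow> bool"
  where "encoder n p r f \<longleftrightarrow> (\<exists>t. t_layer_encoder t n p r f)"

end

theory Submission
  imports Defs
begin

text \<open>
  A constant attention matrix with a single nonzero row broadcasts a column of the value matrix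
  to all columns, so one layer turns the \<open>n p\<close> entries of \<open>X\<close> into \<open>n p\<close> rows that are constant
  along the columns. On such rows a head computes \<open>u ReLU(w)\<close> for affine \<open>u\<close> and \<open>w\<close>. Since
  \<open>u w = u ReLU(w) - u ReLU(-w)\<close> and \<open>max(u, w) = ReLU(u - w) + w\<close>, one further layer performs one
  operation of a max-definable expression, carrying all other rows along. Once all \<open>r p\<close> entries
  of \<open>f\<close> are available, a last layer moves each of them to its column. Under the
  Pierce--Birkhoff conjecture, the entries of a spline are max-definable.
\<close>

section \<open>Encoders as compositions of layers\<close>

definition layer :: "nat \<Rightarrow> nat \<Rightarrow> nat \<Rightarrow> (real mat \<Rightarrow> real mat) \<Rightarrow> bool"
  where "layer p m q L \<longleftrightarrow> (\<exists>h \<alpha> \<phi>. attention_module p m h \<alpha> \<and> columnwise_network p 1 h q \<phi> \<and>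
    (\<forall>X \<in> carrier_mat m p. L X = \<phi> (\<alpha> X)))"

text \<open>Unlike \<open>t_layer_encoder\<close>, this admits \<open>t = 0\<close>, so that
  building up layers can start from the identity.\<close>

definition encodes :: "nat \<Rightarrow> nat \<Rightarrow> nat \<Rightarrow> nat \<Rightarrow> (real mat \<Rightarrow> real mat) \<Rightarrow> bool"
  where "encodes t n p q G \<longleftrightarrow> (\<exists>\<alpha> \<phi>. encoder_layers t (\<lambda>_. 1) n p q \<alpha> \<phi> \<and>
    (\<forall>X \<in> carrier_mat n p. G X = alternate \<alpha> \<phi> t X))"

lemma encodes_id: "encodes 0 n p n id"
  unfolding encodes_def encoder_layers_def by auto

lemma alternate_cong:
  "(\<And>i. i \<in> {1..t} \<Longrightarrow> \<alpha> i = \<alpha>' i \<and> \<phi> i = \<phi>' i) \<Longrightarrow> alternate \<alpha> \<phi> t = alternate \<alpha>' \<phi>' t"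
  by (induction t) simp_all

lemma encodes_step:
  assumes G: "encodes t n p m G" "\<And>X. X \<in> carrier_mat n p \<Longrightarrow> G X \<in> carrier_mat m p"
    and L: "layer p m q L"
    and F: "\<And>X. X \<in> carrier_mat n p \<Longrightarrow> F X = L (G X)"
  shows "encodes (Suc t) n p q F"
proof -
  obtain \<alpha> \<phi> \<mu> \<nu> where \<nu>: "\<nu> 0 = n" "\<nu> t = m"
    and lay: "\<And>i. i \<in> {1..t} \<Longrightarrow> attention_module p (\<nu> (i - 1)) (\<mu> i) (\<alpha> i) \<and>
        columnwise_network p 1 (\<mu> i) (\<nu> i) (\<phi> i)"
    and alt: "\<And>X. X \<in> carrier_mat n p \<Longrightarrow> G X = alternate \<alpha> \<phi> t X"
    using G(1) unfolding encodes_def encoder_layers_def by blast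
  obtain h a f where a: "attention_module p m h a" and f: "columnwise_network p 1 h q f"
    and Leq: "\<And>X. X \<in> carrier_mat m p \<Longrightarrow> L X = f (a X)"
    using L unfolding layer_def by blast
  \<comment> \<open>The first \<open>t\<close> layers put no constraint on index
    \<open>Suc t\<close>, so overwriting it disturbs neither them nor the dimensions
    \<open>\<nu> (i - 1)\<close> that they read.\<close>
  let ?\<alpha> = "\<alpha>(Suc t := a)" and ?\<phi> = "\<phi>(Suc t := f)"
  let ?\<mu> = "\<mu>(Suc t := h)" and ?\<nu> = "\<nu>(Suc t := q)"
  have "attention_module p (?\<nu> (i - 1)) (?\<mu> i) (?\<alpha> i) \<and>
      columnwise_network p 1 (?\<mu> i) (?\<nu> i) (?\<phi> i)" if "i \<in> {1..Suc t}" for i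
  proof (cases "i = Suc t")
    case True
    then show ?thesis using a f \<nu> by simp
  next
    case False
    then have "i \<in> {1..t}" "i - 1 \<noteq> Suc t" using that by auto
    then show ?thesis using lay[of i] False by simp
  qed
  then have "encoder_layers (Suc t) (\<lambda>_. 1) n p q ?\<alpha> ?\<phi>"
    unfolding encoder_layers_def using \<nu> by (intro exI[of _ ?\<mu>] exI[of _ ?\<nu>]) simp
  moreover have "alternate ?\<alpha> ?\<phi> t = alternate \<alpha> \<phi> t"
    by (rule alternate_cong) auto
  then have "\<forall>X \<in> carrier_mat n p. F X = alternate ?\<alpha> ?\<phi> (Suc t) X"
    using F alt Leq G(2) by simp
  ultimately show ?thesis unfolding encodes_def by blast
qed

lemma encodes_encoder:
  assumes "encodes (Suc t) n p q f"
  shows "t_layer_encoder (Suc t) n p q f"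
  using assms unfolding encodes_def t_layer_encoder_def
  by (intro conjI) (simp, fastforce intro!: exI[of _ "\<lambda>_. 1"])

section \<open>Functions computed by a single layer\<close>

lemma ReLU_0 [simp]: "ReLU 0 = 0" and ReLU_1 [simp]: "ReLU 1 = 1"
  by (simp_all add: ReLU_def)

lemma ReLU_diff: "ReLU v - ReLU (- v) = v"
  by (simp add: ReLU_def max_def)

lemma index_mult_mat_sum:
  fixes A B :: "'a :: semiring_0 mat"
  assumes "A \<in> carrier_mat a b" "B \<in> carrier_mat b c" "i < a" "j < c"
  shows "(A * B) $$ (i, j) = (\<Sum>k<b. A $$ (i, k) * B $$ (k, j))"
  using assms by (auto simp: scalar_prod_def atLeast0LessThan)

text \<open>With inner dimension 1 the product of transposed keys and queries is an outer product,
  of which only row \<open>k0\<close> is nonzero. As \<open>ReLU 0 = 0\<close>, activation keeps the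
  other rows zero, and multiplication by \<open>V\<close> picks out its column
  \<open>k0\<close>.\<close>

lemma attention_select_index:
  assumes V: "V \<in> carrier_mat 1 p" and K: "K \<in> carrier_mat 1 p" and Q: "Q \<in> carrier_mat 1 p"
    and k0: "k0 < p" and j: "j < p" and K0: "\<And>k. k < p \<Longrightarrow> K $$ (0, k) = of_bool (k = k0)"
  shows "(V * map_mat ReLU (transpose_mat K * Q)) $$ (0, j) = V $$ (0, k0) * ReLU (Q $$ (0, j))"
proof -
  define M where "M = transpose_mat K * Q"
  have M: "M \<in> carrier_mat p p" using K Q by (auto simp: M_def)
  have S: "M $$ (k, j) = of_bool (k = k0) * Q $$ (0, j)" if "k < p" for k
    using that j K Q K0[OF that]
    by (simp add: M_def index_mult_mat_sum[of _ p 1 _ p] del: index_mult_mat(1))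
  have "(V * map_mat ReLU M) $$ (0, j) = (\<Sum>k<p. V $$ (0, k) * ReLU (M $$ (k, j)))"
    using V M j by (subst index_mult_mat_sum[of _ 1 p _ p]) auto
  also have "\<dots> = (\<Sum>k<p. if k = k0 then V $$ (0, k0) * ReLU (Q $$ (0, j)) else 0)"
    by (rule sum.cong) (auto simp: S)
  finally show ?thesis using k0 by (simp add: M_def)
qed

text \<open>
  The key matrix is \<open>1 \<times> p\<close> and constant, with a single entry 1, in column \<open>k0\<close>: this reads
  the value at column \<open>k0\<close> and makes it available to every column.
\<close>

lemma single_head_attention_select:
  fixes u w :: "nat \<Rightarrow> real" and u0 :: real and w0 :: "nat \<Rightarrow> real"
  assumes k0: "k0 < p"
  shows "\<exists>H. single_head_attention p n 1 H \<and>
    (\<forall>X \<in> carrier_mat n p. \<forall>j<p. H X $$ (0, j) =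
      ((\<Sum>a<n. u a * X $$ (a, k0)) + u0) * ReLU ((\<Sum>a<n. w a * X $$ (a, j)) + w0 j))"
proof -
  define AQ where "AQ = mat 1 n (\<lambda>(_, a). w a)"
  define AV where "AV = mat 1 n (\<lambda>(_, a). u a)"
  define AK :: "real mat" where "AK = 0\<^sub>m 1 n"
  \<comment> \<open>The query bias may differ from column to column; this later confines a value to
    a chosen column.\<close>
  define BQ where "BQ = mat 1 p (\<lambda>(_, j). w0 j)"
  define BV where "BV = mat 1 p (\<lambda>_. u0)"
  define BK :: "real mat" where "BK = mat 1 p (\<lambda>(_, k). of_bool (k = k0))"
  define H where "H = (\<lambda>X. (AV * X + BV) *
      map_mat ReLU (transpose_mat (AK * X + BK) * (AQ * X + BQ)))"
  have "single_head_attention p n 1 H"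
    unfolding single_head_attention_def
    by (intro conjI exI[of _ 1] exI[of _ AQ] exI[of _ AK] exI[of _ AV]
          exI[of _ BQ] exI[of _ BK] exI[of _ BV])
      (simp_all add: AQ_def AK_def AV_def BQ_def BK_def BV_def H_def)
  moreover have "H X $$ (0, j) =
      ((\<Sum>a<n. u a * X $$ (a, k0)) + u0) * ReLU ((\<Sum>a<n. w a * X $$ (a, j)) + w0 j)"
    if X: "X \<in> carrier_mat n p" and j: "j < p" for X j
  proof -
    have V: "(AV * X + BV) $$ (0, k) = (\<Sum>a<n. u a * X $$ (a, k)) + u0" if "k < p" for k
      using that X by (simp add: AV_def BV_def scalar_prod_def atLeast0LessThan)
    have Q: "(AQ * X + BQ) $$ (0, j) = (\<Sum>a<n. w a * X $$ (a, j)) + w0 j"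
      using j X by (simp add: AQ_def BQ_def scalar_prod_def atLeast0LessThan)
    have K: "(AK * X + BK) $$ (0, k) = of_bool (k = k0)" if "k < p" for k
      using that X by (simp add: AK_def BK_def scalar_prod_def)
    have dims: "AV * X + BV \<in> carrier_mat 1 p" "AQ * X + BQ \<in> carrier_mat 1 p"
      "AK * X + BK \<in> carrier_mat 1 p"
      by (simp_all add: BV_def BQ_def BK_def)
    have "H X $$ (0, j) = (AV * X + BV) $$ (0, k0) * ReLU ((AQ * X + BQ) $$ (0, j))"
      unfolding H_def by (rule attention_select_index[OF dims(1) dims(3) dims(2) k0 j K])
    then show ?thesis by (simp only: V[OF k0] Q)
  qed
  ultimately show ?thesis by blast
qed

text \<open>The rows of \<open>h\<close> heads of height 1 are stacked, head \<open>s\<close>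
  reading its value at column \<open>k s\<close>. The hidden layer has identity weights and zero
  bias, hence only applies \<open>ReLU\<close>; the output map has weights \<open>P\<close> and bias
  \<open>b\<close>.\<close>

lemma layer_exists:
  fixes U W P :: "nat \<Rightarrow> nat \<Rightarrow> real" and u0 b :: "nat \<Rightarrow> real" and w0 :: "nat \<Rightarrow> nat \<Rightarrow> real"
  assumes h: "1 \<le> h" and q: "1 \<le> q" and k: "\<And>s. s < h \<Longrightarrow> k s < p"
  shows "layer p m q (\<lambda>X. mat q p (\<lambda>(i, j).
    (\<Sum>s<h. P i s * ReLU (((\<Sum>a<m. U s a * X $$ (a, k s)) + u0 s) *
      ReLU ((\<Sum>a<m. W s a * X $$ (a, j)) + w0 s j))) + b i))"
proof -
  let ?y = "\<lambda>X s j. ((\<Sum>a<m. U s a * X $$ (a, k s)) + u0 s) *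
      ReLU ((\<Sum>a<m. W s a * X $$ (a, j)) + w0 s j)"
  define good where "good s H \<longleftrightarrow> single_head_attention p m 1 H \<and>
      (\<forall>X \<in> carrier_mat m p. \<forall>j<p. H X $$ (0, j) = ?y X s j)" for s H
  have "\<forall>s. \<exists>H. s < h \<longrightarrow> good s H"
    using single_head_attention_select[OF k] unfolding good_def by simp
  then obtain H' where "\<forall>s. s < h \<longrightarrow> good s (H' s)"
    using choice[of "\<lambda>s H. s < h \<longrightarrow> good s H"] by blast
  then obtain H where H: "\<And>s. s < h \<Longrightarrow> single_head_attention p m 1 (H s)"
    and Hy: "\<And>s X j. s < h \<Longrightarrow> X \<in> carrier_mat m p \<Longrightarrow> j < p \<Longrightarrow> H s X $$ (0, j) = ?y X s j"
    unfolding good_def by blast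
  define \<alpha> where "\<alpha> = (\<lambda>X. mat h p (\<lambda>(i, j). H i X $$ (0, j)))"
  have \<alpha>: "attention_module p m h \<alpha>"
    unfolding attention_module_def \<alpha>_def
    by (rule exI[of _ h], rule exI[of _ 1], rule exI[of _ H]) (use h H in simp)
  \<comment> \<open>Indices 0, 1, 2 carry the dimensions \<open>h\<close>, \<open>h\<close>,
    \<open>q\<close>. Weights and biases are read at 1 and 2 only, so two cases suffice for
    them.\<close>
  define d where "d = (\<lambda>i. if i = Suc (Suc 0) then q else h)"
  define A where "A = (\<lambda>i. if i = Suc 0 then 1\<^sub>m h else mat q h (\<lambda>(i, s). P i s))"
  define c where "c = (\<lambda>i. if i = Suc 0 then 0\<^sub>v h else vec q b)"
  define f where "f = (\<lambda>x. A 2 *\<^sub>v hidden A c 1 x + c 2)"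
  have "neural_network 1 h q f"
    unfolding neural_network_def
    by (rule exI[of _ d], rule exI[of _ A], rule exI[of _ c])
      (use h q in \<open>auto simp: d_def A_def c_def f_def numeral_2_eq_2\<close>)
  define \<phi> where "\<phi> = (\<lambda>X. mat_of_cols q (map f (cols X)))"
  have \<phi>: "columnwise_network p 1 h q \<phi>"
    unfolding columnwise_network_def \<phi>_def using \<open>neural_network 1 h q f\<close> by blast
  have f: "f x $ i = (\<Sum>s<h. P i s * ReLU (x $ s)) + b i" if "x \<in> carrier_vec h" "i < q" for x i
    using that by (simp add: f_def A_def c_def scalar_prod_def atLeast0LessThan)
  have "mat q p (\<lambda>(i, j). (\<Sum>s<h. P i s * ReLU (?y X s j)) + b i) = \<phi> (\<alpha> X)"
    if X: "X \<in> carrier_mat m p" for X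
  proof (rule eq_matI)
    fix i j assume "i < dim_row (\<phi> (\<alpha> X))" "j < dim_col (\<phi> (\<alpha> X))"
    then have ij: "i < q" "j < p" by (simp_all add: \<phi>_def \<alpha>_def)
    then have "\<phi> (\<alpha> X) $$ (i, j) = f (col (\<alpha> X) j) $ i"
      by (simp add: \<phi>_def mat_of_cols_def \<alpha>_def)
    also have "\<dots> = (\<Sum>s<h. P i s * ReLU (?y X s j)) + b i"
      using ij by (subst f) (simp_all add: \<alpha>_def Hy[OF _ X])
    finally show "mat q p (\<lambda>(i, j). (\<Sum>s<h. P i s * ReLU (?y X s j)) + b i) $$ (i, j)
        = \<phi> (\<alpha> X) $$ (i, j)"
      using ij by simp
  qed (simp_all add: \<phi>_def \<alpha>_def)
  then show ?thesis unfolding layer_def using \<alpha> \<phi> by blast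
qed

text \<open>Doubling the heads, \<open>y = ReLU y - ReLU (- y)\<close> lets the ReLU of the network be undone.\<close>

lemma layer_linear:
  fixes U P :: "nat \<Rightarrow> nat \<Rightarrow> real" and w0 :: "nat \<Rightarrow> nat \<Rightarrow> real"
  assumes h: "1 \<le> h" and q: "1 \<le> q" and k: "\<And>s. s < h \<Longrightarrow> k s < p"
  shows "layer p m q (\<lambda>X. mat q p (\<lambda>(i, j).
    \<Sum>s<h. P i s * ((\<Sum>a<m. U s a * X $$ (a, k s)) * ReLU (w0 s j))))"
proof -
  define \<epsilon> :: "nat \<Rightarrow> real" where "\<epsilon> s = (if s < h then 1 else -1)" for s
  have split: "(\<Sum>s<h + h. g s) = (\<Sum>s<h. g s + g (h + s))" for g :: "nat \<Rightarrow> real"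
  proof -
    have "(\<Sum>s<h + l. g s) = (\<Sum>s<h. g s) + (\<Sum>s<l. g (h + s))" for l
      by (induction l) (simp_all add: add.assoc)
    then show ?thesis by (simp add: sum.distrib)
  qed
  \<comment> \<open>The sign enters both the value and the output weight, so heads \<open>s\<close>
    and \<open>h + s\<close> contribute \<open>P i s\<close> times a difference
    \<open>ReLU y - ReLU (- y)\<close>. Zero query weights leave the factor
    \<open>ReLU (w0 s j)\<close>.\<close>
  have "layer p m q (\<lambda>X. mat q p (\<lambda>(i, j). (\<Sum>s<h + h. \<epsilon> s * P i (s mod h) *
      ReLU (((\<Sum>a<m. \<epsilon> s * U (s mod h) a * X $$ (a, k (s mod h))) + 0) *
        ReLU ((\<Sum>a<m. 0 * X $$ (a, j)) + w0 (s mod h) j))) + 0))"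
    by (rule layer_exists[of "h + h" q "\<lambda>s. k (s mod h)" p m
          "\<lambda>i s. \<epsilon> s * P i (s mod h)" "\<lambda>s a. \<epsilon> s * U (s mod h) a" "\<lambda>_. 0" "\<lambda>_ _. 0"
          "\<lambda>s j. w0 (s mod h) j" "\<lambda>_. 0"])
      (use h q k in auto)
  moreover have "(\<Sum>s<h + h. \<epsilon> s * P i (s mod h) *
      ReLU (((\<Sum>a<m. \<epsilon> s * U (s mod h) a * X $$ (a, k (s mod h))) + 0) *
        ReLU ((\<Sum>a<m. 0 * X $$ (a, j)) + w0 (s mod h) j))) + 0 =
      (\<Sum>s<h. P i s * ((\<Sum>a<m. U s a * X $$ (a, k s)) * ReLU (w0 s j)))" for X i j
    unfolding split by (simp add: \<epsilon>_def sum_negf right_diff_distrib[symmetric] ReLU_diff)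
  ultimately show ?thesis by (simp cong: if_cong)
qed

section \<open>Function classes generated by one layer\<close>

text \<open>The generators may be infinitely many, like the heads available to a layer; finite
  coefficient families are extracted only afterwards.\<close>

inductive_set affine_span :: "('a \<Rightarrow> real) set \<Rightarrow> ('a \<Rightarrow> real) set" for S
  where
    const: "(\<lambda>_. b) \<in> affine_span S"
  | base: "g \<in> S \<Longrightarrow> g \<in> affine_span S"
  | add: "g \<in> affine_span S \<Longrightarrow> h \<in> affine_span S \<Longrightarrow> (\<lambda>x. g x + h x) \<in> affine_span S"
  | scale: "g \<in> affine_span S \<Longrightarrow> (\<lambda>x. c * g x) \<in> affine_span S"

lemma affine_span_uminus: "g \<in> affine_span S \<Longrightarrow> (\<lambda>x. - g x) \<in> affine_span S"
  using affine_span.scale[of g S "-1"] by simp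

lemma affine_span_diff:
  "g \<in> affine_span S \<Longrightarrow> h \<in> affine_span S \<Longrightarrow> (\<lambda>x. g x - h x) \<in> affine_span S"
  using affine_span.add[OF _ affine_span_uminus] by fastforce

lemma affine_span_mono: "g \<in> affine_span S \<Longrightarrow> S \<subseteq> T \<Longrightarrow> g \<in> affine_span T"
  by (induction rule: affine_span.induct) (auto intro: affine_span.intros)

text \<open>A derivation uses only finitely many generators, which is why finitely many heads
  suffice.\<close>

lemma affine_span_finite:
  assumes "g \<in> affine_span S"
  shows "\<exists>T. finite T \<and> T \<subseteq> S \<and> g \<in> affine_span T"
  using assms
proof (induction rule: affine_span.induct)
  case (const b)
  then show ?case by (intro exI[of _ "{}"]) (auto intro: affine_span.const)
next
  case (base g)
  then show ?case by (intro exI[of _ "{g}"]) (auto intro: affine_span.base)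
next
  case (add g h)
  then obtain T T' where "finite T" "T \<subseteq> S" "g \<in> affine_span T"
    "finite T'" "T' \<subseteq> S" "h \<in> affine_span T'" by blast
  then show ?case
    by (intro exI[of _ "T \<union> T'"]) (auto intro!: affine_span.add intro: affine_span_mono)
next
  case (scale g c)
  then show ?case by (auto intro: affine_span.scale)
qed

text \<open>All rows of a layer share their heads, so the generators needed for each are
  united.\<close>

lemma affine_span_finite_subset:
  assumes "finite Z" "Z \<subseteq> affine_span S"
  shows "\<exists>T. finite T \<and> T \<subseteq> S \<and> Z \<subseteq> affine_span T"
  using assms
proof (induction rule: finite_induct)
  case (insert z Z)
  obtain T T' where "finite T" "T \<subseteq> S" "z \<in> affine_span T"
    "finite T'" "T' \<subseteq> S" "Z \<subseteq> affine_span T'"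
    using insert affine_span_finite[of z S] by auto
  then show ?case
    by (intro exI[of _ "T \<union> T'"]) (auto intro: affine_span_mono)
qed auto

lemma affine_span_listE:
  assumes "g \<in> affine_span (set gs)"
  obtains c b where "\<And>x. g x = (\<Sum>a<length gs. c a * (gs ! a) x) + b"
proof -
  have "\<exists>c b. \<forall>x. g x = (\<Sum>a<length gs. c a * (gs ! a) x) + b"
    using assms
  proof (induction rule: affine_span.induct)
    case (const b)
    then show ?case by (intro exI[of _ "\<lambda>_. 0"] exI[of _ b]) simp
  next
    case (base g)
    then obtain i where "i < length gs" "g = gs ! i" by (metis in_set_conv_nth)
    then show ?case
      by (intro exI[of _ "\<lambda>a. of_bool (a = i)"] exI[of _ 0]) simp
  next
    case (add g h)
    then obtain c b c' b' where "\<forall>x. g x = (\<Sum>a<length gs. c a * (gs ! a) x) + b"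
      "\<forall>x. h x = (\<Sum>a<length gs. c' a * (gs ! a) x) + b'" by blast
    then show ?case
      by (intro exI[of _ "\<lambda>a. c a + c' a"] exI[of _ "b + b'"])
        (simp add: algebra_simps sum.distrib)
  next
    case (scale g e)
    then obtain c b where "\<forall>x. g x = (\<Sum>a<length gs. c a * (gs ! a) x) + b" by blast
    then show ?case
      by (intro exI[of _ "\<lambda>a. e * c a"] exI[of _ "e * b"])
        (simp add: algebra_simps sum_distrib_left)
  qed
  then show ?thesis using that by blast
qed

text \<open>The outputs of a head whose input rows are the functions in \<open>S\<close>. Both
  factors are taken at the same \<open>x\<close>, as fits rows that are constant along the
  columns.\<close>

definition heads :: "('a \<Rightarrow> real) set \<Rightarrow> ('a \<Rightarrow> real) set"
  where "heads S = {(\<lambda>x. u x * ReLU (w x)) | u w. u \<in> affine_span S \<and> w \<in> affine_span S}"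

text \<open>Hidden units are rectified heads, and the output map of the network is affine in
  them.\<close>

definition layer_span :: "('a \<Rightarrow> real) set \<Rightarrow> ('a \<Rightarrow> real) set"
  where "layer_span S = affine_span ((\<lambda>y x. ReLU (y x)) ` heads S)"

text \<open>The ReLU of the network is undone by pairing the heads with values \<open>u\<close> and
  \<open>- u\<close> and the same query.\<close>

lemma layer_span_ReLU_mult:
  assumes "u \<in> affine_span S" "w \<in> affine_span S"
  shows "(\<lambda>x. u x * ReLU (w x)) \<in> layer_span S"
proof -
  have "(\<lambda>x. u' x * ReLU (w x)) \<in> heads S" if "u' \<in> affine_span S" for u'
    using that assms(2) unfolding heads_def by blast
  from this[OF assms(1)] this[OF affine_span_uminus[OF assms(1)]]
  have "(\<lambda>x. ReLU (u x * ReLU (w x))) \<in> layer_span S"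
    "(\<lambda>x. ReLU (- u x * ReLU (w x))) \<in> layer_span S"
    unfolding layer_span_def by (auto intro!: affine_span.base)
  then have "(\<lambda>x. ReLU (u x * ReLU (w x)) - ReLU (- u x * ReLU (w x))) \<in> layer_span S"
    unfolding layer_span_def by (rule affine_span_diff)
  then show ?thesis by (simp add: ReLU_diff)
qed

text \<open>A constant query gives the factor \<open>ReLU 1 = 1\<close>; this carries existing rows
  through a layer.\<close>

lemma layer_span_affine: "u \<in> affine_span S \<Longrightarrow> u \<in> layer_span S"
  using layer_span_ReLU_mult[OF _ affine_span.const[of 1]] by simp

lemma layer_span_mult:
  assumes "u \<in> affine_span S" "w \<in> affine_span S"
  shows "(\<lambda>x. u x * w x) \<in> layer_span S"
proof -
  have "u x * w x = u x * ReLU (w x) - u x * ReLU (- w x)" for x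
    by (simp add: right_diff_distrib[symmetric] ReLU_diff)
  moreover have "(\<lambda>x. u x * ReLU (w x) - u x * ReLU (- w x)) \<in> layer_span S"
    using layer_span_ReLU_mult[OF assms] layer_span_ReLU_mult[OF assms(1) affine_span_uminus[OF assms(2)]]
    unfolding layer_span_def by (rule affine_span_diff)
  ultimately show ?thesis by simp
qed

lemma layer_span_max:
  assumes "u \<in> affine_span S" "w \<in> affine_span S"
  shows "(\<lambda>x. max (u x) (w x)) \<in> layer_span S"
proof -
  have "max (u x) (w x) = 1 * ReLU (u x - w x) + w x" for x
    by (simp add: ReLU_def max_def)
  moreover have "(\<lambda>x. 1 * ReLU (u x - w x)) \<in> layer_span S" "w \<in> layer_span S"
    by (rule layer_span_ReLU_mult[OF affine_span.const affine_span_diff[OF assms]])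
      (rule layer_span_affine[OF assms(2)])
  then have "(\<lambda>x. 1 * ReLU (u x - w x) + w x) \<in> layer_span S"
    unfolding layer_span_def by (rule affine_span.add)
  ultimately show ?thesis by simp
qed

section \<open>Lists of functions held as broadcast rows\<close>

text \<open>Zero padding puts the point into \<open>Rn (n * p)\<close>, where
  \<open>max_definable\<close> constrains a function.\<close>

definition point_of_mat :: "nat \<Rightarrow> nat \<Rightarrow> real mat \<Rightarrow> nat \<Rightarrow> real"
  where "point_of_mat n p X = (\<lambda>k. if k < n * p then X $$ (k div p, k mod p) else 0)"

lemma point_of_mat_Rn: "point_of_mat n p X \<in> Rn (n * p)"
  by (simp add: point_of_mat_def topspace_Euclidean_space)

lemma mat_of_point_of_mat:
  assumes "X \<in> carrier_mat n p"
  shows "mat_of_point n p (point_of_mat n p X) = X"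
proof (rule eq_matI)
  fix a c assume "a < dim_row X" "c < dim_col X"
  then have ac: "a < n" "c < p" using assms by auto
  then have "a * p + c < Suc a * p" by simp
  also have "\<dots> \<le> n * p" using ac by (intro mult_right_mono) auto
  finally show "mat_of_point n p (point_of_mat n p X) $$ (a, c) = X $$ (a, c)"
    using ac by (simp add: mat_of_point_def point_of_mat_def)
qed (use assms in \<open>simp_all add: mat_of_point_def\<close>)

definition broadcast :: "nat \<Rightarrow> nat \<Rightarrow> ((nat \<Rightarrow> real) \<Rightarrow> real) list \<Rightarrow> real mat \<Rightarrow> real mat"
  where "broadcast n p gs X = mat (length gs) p (\<lambda>(i, j). (gs ! i) (point_of_mat n p X))"

definition reach :: "nat \<Rightarrow> nat \<Rightarrow> ((nat \<Rightarrow> real) \<Rightarrow> real) list \<Rightarrow> bool"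
  where "reach n p gs \<longleftrightarrow> (\<exists>t. encodes t n p (length gs) (broadcast n p gs))"

text \<open>The targets together involve finitely many heads. Listing these and reading off all
  weights gives a layer as in \<open>layer_exists\<close>, which is appended to the encoder for
  \<open>gs\<close>.\<close>

lemma reach_step:
  assumes p: "1 \<le> p" and gs: "reach n p gs"
    and zs: "zs \<noteq> []" "set zs \<subseteq> layer_span (set gs)"
  shows "reach n p zs"
proof -
  obtain t where t: "encodes t n p (length gs) (broadcast n p gs)"
    using gs unfolding reach_def by blast
  obtain T where T: "finite T" "T \<subseteq> (\<lambda>y x. ReLU (y x)) ` heads (set gs)" "set zs \<subseteq> affine_span T"
    using affine_span_finite_subset[OF finite_set zs(2)[unfolded layer_span_def]] by blast
  obtain Y where Y: "Y \<subseteq> heads (set gs)" "finite Y" "T = (\<lambda>y x. ReLU (y x)) ` Y"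
    using finite_subset_image[OF T(1,2)] by blast
  \<comment> \<open>Constant targets could leave the list of heads empty, but a module has at least
    one; the zero head is added for this.\<close>
  have zero: "(\<lambda>x. 0 * ReLU 0) \<in> heads (set gs)"
    unfolding heads_def
    by (rule CollectI, rule exI[of _ "\<lambda>_. 0"], rule exI[of _ "\<lambda>_. 0"]) (simp add: affine_span.const)
  obtain ys where ys: "set ys \<subseteq> heads (set gs)" "ys \<noteq> []"
    and zy: "set zs \<subseteq> affine_span (set (map (\<lambda>y x. ReLU (y x)) ys))"
  proof -
    obtain ys where "set ys = Y" using Y(2) finite_list by blast
    then have "T \<subseteq> set (map (\<lambda>y x. ReLU (y x)) ((\<lambda>x. 0 * ReLU 0) # ys))"
      using Y(3) by auto
    then have "set zs \<subseteq> affine_span (set (map (\<lambda>y x. ReLU (y x)) ((\<lambda>x. 0 * ReLU 0) # ys)))"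
      using T(3) affine_span_mono by blast
    then show ?thesis
      using \<open>set ys = Y\<close> zero Y(1) by (intro that[of "(\<lambda>x. 0 * ReLU 0) # ys"]) auto
  qed
  define headed where "headed s U u0 W w0 \<longleftrightarrow> (\<forall>x. (ys ! s) x =
      ((\<Sum>a<length gs. U a * (gs ! a) x) + u0) *
      ReLU ((\<Sum>a<length gs. W a * (gs ! a) x) + w0))" for s U u0 W w0
  have "\<exists>U u0 W w0. headed s U u0 W w0" if "s < length ys" for s
  proof -
    have "ys ! s \<in> heads (set gs)" using ys that by auto
    then obtain u w where y: "ys ! s = (\<lambda>x. u x * ReLU (w x))"
      and uw: "u \<in> affine_span (set gs)" "w \<in> affine_span (set gs)"
      unfolding heads_def by blast
    obtain U u0 where u: "\<And>x. u x = (\<Sum>a<length gs. U a * (gs ! a) x) + u0"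
      by (rule affine_span_listE[OF uw(1)]) blast
    obtain W w0 where w: "\<And>x. w x = (\<Sum>a<length gs. W a * (gs ! a) x) + w0"
      by (rule affine_span_listE[OF uw(2)]) blast
    show ?thesis unfolding headed_def y u w by blast
  qed
  then obtain U u0 W w0 where "\<And>s. s < length ys \<Longrightarrow> headed s (U s) (u0 s) (W s) (w0 s)"
    by metis
  then have y: "(ys ! s) x = ((\<Sum>a<length gs. U s a * (gs ! a) x) + u0 s) *
      ReLU ((\<Sum>a<length gs. W s a * (gs ! a) x) + w0 s)" if "s < length ys" for s x
    using that unfolding headed_def by blast
  define combined where "combined i P b \<longleftrightarrow>
      (\<forall>x. (zs ! i) x = (\<Sum>s<length ys. P s * ReLU ((ys ! s) x)) + b)" for i P b
  have "\<exists>P b. combined i P b" if "i < length zs" for i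
  proof -
    have "zs ! i \<in> affine_span (set (map (\<lambda>y x. ReLU (y x)) ys))" using zy that by auto
    then obtain P b where "\<And>x. (zs ! i) x =
        (\<Sum>s<length (map (\<lambda>y x. ReLU (y x)) ys). P s * (map (\<lambda>y x. ReLU (y x)) ys ! s) x) + b"
      by (rule affine_span_listE) blast
    then show ?thesis unfolding combined_def by (intro exI[of _ P] exI[of _ b]) simp
  qed
  then obtain P b where "\<And>i. i < length zs \<Longrightarrow> combined i (P i) (b i)"
    by metis
  then have z: "(zs ! i) x = (\<Sum>s<length ys. P i s * ReLU ((ys ! s) x)) + b i"
    if "i < length zs" for i x
    using that unfolding combined_def by blast
  \<comment> \<open>Every head reads its value at column 0, which represents all columns of a
    broadcast matrix.\<close>
  let ?L = "\<lambda>X. mat (length zs) p (\<lambda>(i, j).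
    (\<Sum>s<length ys. P i s * ReLU (((\<Sum>a<length gs. U s a * X $$ (a, 0)) + u0 s) *
      ReLU ((\<Sum>a<length gs. W s a * X $$ (a, j)) + w0 s))) + b i)"
  have L: "layer p (length gs) (length zs) ?L"
    by (rule layer_exists[of _ _ "\<lambda>_. 0" _ _ _ _ _ _ "\<lambda>s j. w0 s"])
      (use ys zs p in \<open>auto simp: Suc_le_eq\<close>)
  have "encodes (Suc t) n p (length zs) (broadcast n p zs)"
    by (rule encodes_step[OF t _ L])
      (use p in \<open>auto simp: broadcast_def z y intro!: eq_matI\<close>)
  then show ?thesis unfolding reach_def by blast
qed

definition coords :: "nat \<Rightarrow> ((nat \<Rightarrow> real) \<Rightarrow> real) list"
  where "coords N = map (\<lambda>k x. x k) [0..<N]"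

text \<open>Head \<open>s\<close> reads the entry at row \<open>s div p\<close> and column
  \<open>s mod p\<close>, inverting the row-by-row numbering. The constant query 1 repeats it in
  every column, and the network routes it to row \<open>s\<close>.\<close>

lemma reach_coords:
  assumes "1 \<le> n" "1 \<le> p"
  shows "reach n p (coords (n * p))"
proof -
  let ?N = "n * p"
  let ?L = "\<lambda>X. mat ?N p (\<lambda>(i, j). \<Sum>s<?N. of_bool (s = i) *
      ((\<Sum>a<n. of_bool (a = s div p) * X $$ (a, s mod p)) * ReLU 1))"
  have L: "layer p n ?N ?L"
    by (rule layer_linear[of ?N ?N "\<lambda>s. s mod p" p n "\<lambda>i s. of_bool (s = i)"
          "\<lambda>s a. of_bool (a = s div p)" "\<lambda>_ _. 1"])
      (use assms in auto)
  have "broadcast n p (coords ?N) X = ?L (id X)" for X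
  proof (rule eq_matI)
    fix i j assume "i < dim_row (?L (id X))" "j < dim_col (?L (id X))"
    then have ij: "i < ?N" "j < p" by auto
    then have "i div p < n" by (simp add: less_mult_imp_div_less)
    then show "broadcast n p (coords ?N) X $$ (i, j) = ?L (id X) $$ (i, j)"
      using ij by (simp add: broadcast_def coords_def point_of_mat_def)
  qed (simp_all add: broadcast_def coords_def)
  then have "encodes (Suc 0) n p ?N (broadcast n p (coords ?N))"
    by (intro encodes_step[OF encodes_id _ L]) simp_all
  moreover have "length (coords ?N) = ?N" by (simp add: coords_def)
  ultimately show ?thesis unfolding reach_def by metis
qed

text \<open>Induction on the generation of \<open>g\<close> for arbitrary \<open>gs\<close>: for a
  binary operation, the second operand is put in front of \<open>gs\<close>, the first in front of
  that, and one further layer combines the two while retaining \<open>gs\<close>.\<close>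

lemma reach_Cons_max_generated:
  assumes p: "1 \<le> p" and g: "g \<in> max_generated N" and gs: "reach n p gs"
    and vars: "set (coords N) \<subseteq> set gs"
  shows "reach n p (g # gs)"
proof -
  have keep: "reach n p (f # hs)"
    if "reach n p hs'" "f \<in> layer_span (set hs')" "set hs \<subseteq> set hs'" for f hs hs'
  proof (rule reach_step[OF p that(1)])
    have "set hs' \<subseteq> layer_span (set hs')"
      by (auto intro: layer_span_affine affine_span.base)
    then show "set (f # hs) \<subseteq> layer_span (set hs')" using that(2,3) by auto
  qed simp
  show ?thesis using g gs vars
  proof (induction arbitrary: gs rule: max_generated.induct)
    case one
    show ?case by (rule keep[OF one(1)]) (auto intro: layer_span_affine affine_span.const)
  next
    case (var i)
    then have "(\<lambda>x. x i) \<in> set gs" by (auto simp: coords_def)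
    then show ?case by (intro keep[OF var(2)]) (auto intro: layer_span_affine affine_span.base)
  next
    case (add g h)
    have "reach n p (g # h # gs)"
      using add.prems by (intro add.IH) auto
    then show ?case
      by (rule keep[OF _ layer_span_affine[OF affine_span.add[OF affine_span.base affine_span.base]]]) auto
  next
    case (mult g h)
    have "reach n p (g # h # gs)"
      using mult.prems by (intro mult.IH) auto
    then show ?case
      by (rule keep[OF _ layer_span_mult[OF affine_span.base affine_span.base]]) auto
  next
    case (max g h)
    have "reach n p (g # h # gs)"
      using max.prems by (intro max.IH) auto
    then show ?case
      by (rule keep[OF _ layer_span_max[OF affine_span.base affine_span.base]]) auto
  next
    case (scale g c)
    have "reach n p (g # gs)"
      using scale.prems by (intro scale.IH) auto
    then show ?case
      by (rule keep[OF _ layer_span_affine[OF affine_span.scale[OF affine_span.base]]]) auto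
  qed
qed

lemma reach_append_max_generated:
  assumes "1 \<le> p" "reach n p gs" "set (coords N) \<subseteq> set gs" "set ws \<subseteq> max_generated N"
  shows "reach n p (ws @ gs)"
  using assms(4) by (induction ws) (auto intro!: reach_Cons_max_generated[of p _ N] assms dest: assms(3)[THEN subsetD])

section \<open>Max-definable matrix functions\<close>

text \<open>The layer that moves the computed entries into place accounts for the
  \<open>Suc\<close>, and so provides the at least one layer that an encoder must have.\<close>

lemma encodes_max_definable_mat:
  assumes n: "1 \<le> n" and p: "1 \<le> p" and r: "1 \<le> r"
    and f: "f \<in> carrier_mat n p \<rightarrow> carrier_mat r p" and md: "max_definable_mat n p r f"
  shows "\<exists>t. encodes (Suc t) n p r f"
proof -
  have bound: "i * p + j < r * p" if "i < r" "j < p" for i j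
  proof -
    have "i * p + j < Suc i * p" using that by simp
    also have "\<dots> \<le> r * p" using that by (intro mult_right_mono) auto
    finally show ?thesis .
  qed
  have "\<forall>i j. \<exists>g. i < r \<longrightarrow> j < p \<longrightarrow> g \<in> max_generated (n * p) \<and>
      (\<forall>x \<in> Rn (n * p). entry_fun n p f i j x = g x)"
    using md unfolding max_definable_mat_def max_definable_def by blast
  then obtain g where g: "\<And>i j. i < r \<Longrightarrow> j < p \<Longrightarrow> g i j \<in> max_generated (n * p)"
    and gf: "\<And>i j x. i < r \<Longrightarrow> j < p \<Longrightarrow> x \<in> Rn (n * p) \<Longrightarrow> entry_fun n p f i j x = g i j x"
    by metis
  \<comment> \<open>Row-by-row order, placed before the coordinates in \<open>gs\<close>, so that
    row \<open>i * p + j\<close> of the broadcast matrix holds entry \<open>(i, j)\<close>.\<close>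
  define ws where "ws = map (\<lambda>s. g (s div p) (s mod p)) [0..<r * p]"
  define gs where "gs = ws @ coords (n * p)"
  have "set ws \<subseteq> max_generated (n * p)"
    using p by (auto simp: ws_def less_mult_imp_div_less intro!: g)
  then have "reach n p gs"
    unfolding gs_def by (intro reach_append_max_generated[OF p reach_coords[OF n p]]) auto
  then obtain t where t: "encodes t n p (length gs) (broadcast n p gs)"
    unfolding reach_def by blast
  have len: "r * p \<le> length gs" by (simp add: gs_def ws_def)
  \<comment> \<open>Head \<open>s\<close> reads row \<open>s\<close>; its query is 1 in column
    \<open>s mod p\<close> and 0 elsewhere, so the value survives in that column only. The output
    weights send it to row \<open>s div p\<close>.\<close>
  let ?L = "\<lambda>X. mat r p (\<lambda>(i, j). \<Sum>s<r * p. of_bool (s div p = i) *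
      ((\<Sum>a<length gs. of_bool (a = s) * X $$ (a, 0)) * ReLU (of_bool (s mod p = j))))"
  have L: "layer p (length gs) r ?L"
    by (rule layer_linear[of "r * p" r "\<lambda>_. 0" p "length gs" "\<lambda>i s. of_bool (s div p = i)"
          "\<lambda>s a. of_bool (a = s)" "\<lambda>s j. of_bool (s mod p = j)"])
      (use p r in auto)
  have "encodes (Suc t) n p r f"
  proof (rule encodes_step[OF t _ L])
    fix X :: "real mat" assume X: "X \<in> carrier_mat n p"
    show "broadcast n p gs X \<in> carrier_mat (length gs) p" by (simp add: broadcast_def)
    show "f X = ?L (broadcast n p gs X)"
    proof (rule eq_matI)
      fix i j assume "i < dim_row (?L (broadcast n p gs X))" "j < dim_col (?L (broadcast n p gs X))"
      then have ij: "i < r" "j < p" by auto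
      have "?L (broadcast n p gs X) $$ (i, j) = (\<Sum>s<r * p. of_bool (s div p = i) *
          ((\<Sum>a<length gs. of_bool (a = s) * broadcast n p gs X $$ (a, 0)) * ReLU (of_bool (s mod p = j))))"
        using ij by simp
      also have "\<dots> = (\<Sum>s<r * p. if s = i * p + j then broadcast n p gs X $$ (s, 0) else 0)"
      proof (rule sum.cong)
        fix s assume "s \<in> {..<r * p}"
        then have "s < length gs" using len by simp
        moreover have "s = i * p + j \<longleftrightarrow> s div p = i \<and> s mod p = j"
          using ij by auto
        ultimately show "of_bool (s div p = i) * ((\<Sum>a<length gs. of_bool (a = s) *
            broadcast n p gs X $$ (a, 0)) * ReLU (of_bool (s mod p = j))) =
            (if s = i * p + j then broadcast n p gs X $$ (s, 0) else 0)"
          by simp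
      qed simp
      also have "\<dots> = g i j (point_of_mat n p X)"
        using bound[OF ij] len p ij
        by (simp add: broadcast_def gs_def ws_def nth_append)
      also have "\<dots> = f X $$ (i, j)"
        using gf[OF ij point_of_mat_Rn, of X] mat_of_point_of_mat[OF X] by (simp add: entry_fun_def)
      finally show "f X $$ (i, j) = ?L (broadcast n p gs X) $$ (i, j)" by simp
    qed (use f X in auto)
  qed
  then show ?thesis by blast
qed

section \<open>Max-min polynomials and splines\<close>

lemma max_generated_const: "(\<lambda>_. c) \<in> max_generated N"
  using max_generated.scale[OF max_generated.one, of c N] by simp

lemma max_generated_sum:
  "finite I \<Longrightarrow> (\<And>i. i \<in> I \<Longrightarrow> g i \<in> max_generated N) \<Longrightarrow> (\<lambda>x. \<Sum>i\<in>I. g i x) \<in> max_generated N"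
  by (induction rule: finite_induct) (auto intro: max_generated_const max_generated.add)

lemma max_generated_prod:
  "finite I \<Longrightarrow> (\<And>i. i \<in> I \<Longrightarrow> g i \<in> max_generated N) \<Longrightarrow> (\<lambda>x. \<Prod>i\<in>I. g i x) \<in> max_generated N"
  by (induction rule: finite_induct) (auto intro: max_generated_const max_generated.mult)

lemma max_generated_power: "g \<in> max_generated N \<Longrightarrow> (\<lambda>x. g x ^ k) \<in> max_generated N"
  by (induction k) (auto intro: max_generated_const max_generated.mult)

lemma max_generated_min:
  assumes "g \<in> max_generated N" "h \<in> max_generated N"
  shows "(\<lambda>x. min (g x) (h x)) \<in> max_generated N"
proof -
  have "min (g x) (h x) = - 1 * max (- 1 * g x) (- 1 * h x)" for x
    by (simp add: min_def max_def)
  moreover have "(\<lambda>x. - 1 * max (- 1 * g x) (- 1 * h x)) \<in> max_generated N"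
    by (intro max_generated.scale max_generated.max assms)
  ultimately show ?thesis by simp
qed

lemma max_generated_Max:
  assumes "finite I" "I \<noteq> {}" "\<And>i. i \<in> I \<Longrightarrow> g i \<in> max_generated N"
  shows "(\<lambda>x. Max ((\<lambda>i. g i x) ` I)) \<in> max_generated N"
  using assms by (induction rule: finite_ne_induct) (auto intro: max_generated.max)

lemma max_generated_Min:
  assumes "finite I" "I \<noteq> {}" "\<And>i. i \<in> I \<Longrightarrow> g i \<in> max_generated N"
  shows "(\<lambda>x. Min ((\<lambda>i. g i x) ` I)) \<in> max_generated N"
  using assms by (induction rule: finite_ne_induct) (auto intro: max_generated_min)

text \<open>Evaluation is a finite sum of scaled products of powers; \<open>mpolys N\<close> bounds
  the variable indices, as the generator \<open>var\<close> demands.\<close>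

lemma mpoly_eval_max_generated:
  assumes "P \<in> mpolys N"
  shows "mpoly_eval P \<in> max_generated N"
  unfolding mpoly_eval_def[abs_def]
  using assms unfolding mpolys_def
  by (intro max_generated_sum max_generated.scale max_generated_prod max_generated_power
      max_generated.var) auto

text \<open>The conjecture provides a maximum of minima of polynomials over nonempty index ranges,
  and each of these operations preserves \<open>max_generated N\<close>.\<close>

lemma Pierce_Birkhoff_max_definable:
  assumes "Pierce_Birkhoff" "spline N f"
  shows "max_definable N f"
proof -
  obtain m' p' :: nat and \<xi> where "1 \<le> m'" "1 \<le> p'"
    and \<xi>: "\<And>i j. i \<in> {1..m'} \<Longrightarrow> j \<in> {1..p'} \<Longrightarrow> \<xi> i j \<in> mpolys N"
    and f: "\<forall>x \<in> Rn N. f x = Max ((\<lambda>i. Min ((\<lambda>j. mpoly_eval (\<xi> i j) x) ` {1..p'})) ` {1..m'})"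
    using assms unfolding Pierce_Birkhoff_def by meson
  have "(\<lambda>x. Max ((\<lambda>i. Min ((\<lambda>j. mpoly_eval (\<xi> i j) x) ` {1..p'})) ` {1..m'}))
      \<in> max_generated N"
    by (intro max_generated_Max max_generated_Min mpoly_eval_max_generated \<xi>)
      (use \<open>1 \<le> m'\<close> \<open>1 \<le> p'\<close> in auto)
  then show ?thesis unfolding max_definable_def by (rule bexI[rotated]) (rule f)
qed

theorem theorem3p8:
  fixes n p r :: nat and f :: "real mat \<Rightarrow> real mat"
  assumes "1 \<le> n" and "1 \<le> p" and "1 \<le> r"
    and "f \<in> carrier_mat n p \<rightarrow> carrier_mat r p"
  shows "(max_definable_mat n p r f \<longrightarrow>
      (\<exists>t. t_layer_encoder t n p r f \<and>
        (\<exists>\<alpha> \<phi>. encoder_layers t (\<lambda>_. 1) n p r \<alpha> \<phi> \<and>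
          (\<forall>X \<in> carrier_mat n p. f X = alternate \<alpha> \<phi> t X)))) \<and>
    (Pierce_Birkhoff \<longrightarrow> (\<forall>k. spline_mat k n p r f \<longrightarrow> encoder n p r f))"
proof (intro conjI impI allI)
  note enc = encodes_max_definable_mat[OF assms]
  show "\<exists>t. t_layer_encoder t n p r f \<and>
      (\<exists>\<alpha> \<phi>. encoder_layers t (\<lambda>_. 1) n p r \<alpha> \<phi> \<and>
        (\<forall>X \<in> carrier_mat n p. f X = alternate \<alpha> \<phi> t X))"
    if "max_definable_mat n p r f"
    using enc[OF that] encodes_encoder unfolding encodes_def by blast
  show "encoder n p r f" if "Pierce_Birkhoff" "spline_mat k n p r f" for k
  proof -
    \<comment> \<open>Entry by entry, a matrix spline is a scalar spline in \<open>n * p\<close>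
      variables, to which the conjecture applies.\<close>
    have "max_definable_mat n p r f"
      unfolding max_definable_mat_def
      using that Pierce_Birkhoff_max_definable unfolding spline_mat_def spline_def by blast
    then show ?thesis
      using enc encodes_encoder unfolding encoder_def by blast
  qed
qed

end
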